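(* Let $p$ be a prime, $f\ge 1$ an integer, $q=p^f$, and let $k\ge 1$, $d\ge 1$, $e\ge 0$ be integers. Let $C$ be a $[g_q(k,d),k,d]_q$ Griesmer code. If $p^e\mid d$, then $\left\lceil p^{\,e-(f-1)(q-2)}\right\rceil$ divides $\mathrm{wt}(c)$ for every codeword $c\in C$.
   Context: An $[n,k,d]_q$ code is a $k$-dimensional $\mathbb{F}_q$-linear subspace of $\mathbb{F}_q^n$ whose minimum Hamming weight of a nonzero codeword is $d$; $\mathrm{wt}(c)$ is the number of nonzero coordinates of $c$. For positive integers $k,d$, $g_q(k,d):=\sum_{i=0}^{k-1}\lceil d/q^i\rceil$. An $[n,k,d]_q$ code with $n=g_q(k,d)$ is called a Griesmer code. Codes are assumed to have full length (no coordinate at which all codewords vanish). *)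

theory Defs
  imports "HOL-Analysis.Cartesian_Space" "HOL-Computational_Algebra.Primes"
begin

definition hamming_weight :: "'a::zero ^ 'n \<Rightarrow> nat"
  where "hamming_weight c = card {i. c $ i \<noteq> 0}"

text \<open>Only meaningful for a code containing a nonzero codeword, i.e. of dimension at least 1.\<close>
definition minimum_weight :: "('a::zero ^ 'n) set \<Rightarrow> nat"
  where "minimum_weight C = Min (hamming_weight ` (C - {0}))"

definition full_length :: "('a::zero ^ 'n) set \<Rightarrow> bool"
  where "full_length C \<longleftrightarrow> (\<forall>i. \<exists>c\<in>C. c $ i \<noteq> 0)"

text \<open>
  \<open>C\<close> is an $[n,k,d]_q$ code. The alphabet is the type \<open>'a\<close>, which is
  (up to isomorphism) the field with \<open>q\<close> elements, and the coordinates are indexed by the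
  \<open>n\<close>-element type \<open>'n\<close>. Codes are understood to have full length.
\<close>
definition linear_code :: "('a::{field,finite} ^ 'n) set \<Rightarrow> nat \<Rightarrow> nat \<Rightarrow> nat \<Rightarrow> nat \<Rightarrow> bool"
  where "linear_code C n k d q \<longleftrightarrow>
    CARD('a) = q \<and> CARD('n) = n \<and>
    vec.subspace C \<and> vec.dim C = k \<and> minimum_weight C = d \<and> full_length C"

definition griesmer_bound :: "nat \<Rightarrow> nat \<Rightarrow> nat \<Rightarrow> nat"
  where "griesmer_bound q k d = (\<Sum>i<k. nat \<lceil>real d / real q ^ i\<rceil>)"

definition griesmer_code :: "('a::{field,finite} ^ 'n) set \<Rightarrow> nat \<Rightarrow> nat \<Rightarrow> nat \<Rightarrow> bool"
  where "griesmer_code C k d q \<longleftrightarrow> linear_code C (griesmer_bound q k d) k d q"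

end

theory Submission
  imports Defs "HOL-Number_Theory.Residues" "HOL-Computational_Algebra.Polynomial"
    "HOL-Analysis.Convex"
begin

text \<open>
  Write \<open>e1 = e div f\<close>, so that \<open>q ^ e1\<close> divides \<open>d\<close>. By induction on \<open>k\<close> the support of every
  subcode of dimension at most \<open>s \<le> e1\<close> has size divisible by \<open>p ^ (f * (e1 - s) + 1)\<close>; the case
  \<open>s = 1\<close> is stronger than the claim. Shortening at a coordinate of maximal multiplicity gives a
  Griesmer code of dimension \<open>k - 1\<close> with the same \<open>d\<close>, and counting shows that there are at least
  \<open>1 + q + \<dots> + q ^ e1\<close> such hyperplanes. If a subcode \<open>A\<close> lies in none of them, then by the pigeonhole
  principle more than \<open>q ^ (e1 + 1 - s)\<close> of them meet \<open>A\<close> in the same hyperplane \<open>A1\<close>; take \<open>x\<close> in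
  \<open>A - A1\<close> and count weights outside the support of \<open>A1\<close>. For \<open>s < e1\<close> there is a word \<open>y\<close> such that
  every \<open>y - t x\<close> lies in one of these hyperplanes, and the sum of the weights over the pencil
  spanned by \<open>x\<close> and \<open>y\<close> is \<open>q\<close> times the size of its support, which is controlled by the case
  \<open>s + 1\<close>. For \<open>s = e1\<close> the weight modulo \<open>p\<close> is a polynomial of degree \<open>q - 1\<close> that vanishes on at
  least \<open>q\<close> hyperplanes, hence everywhere.
\<close>

subsection \<open>Subspaces over a finite field\<close>

lemma CARD_field_gt_1: "CARD('a::{field,finite}) > 1"
  using card_mono[of UNIV "{0, 1 :: 'a}"] by simp

definition linear_form :: "('a::field ^ 'n \<Rightarrow> 'a) \<Rightarrow> bool"
  where "linear_form l \<longleftrightarrow> (\<forall>x y. l (x + y) = l x + l y) \<and> (\<forall>c x. l (c *s x) = c * l x)"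

lemma linear_form_nth: "linear_form (\<lambda>x. x $ i)"
  by (simp add: linear_form_def)

lemma linear_form_diff: "linear_form l \<Longrightarrow> l (x - y) = l x - l y"
  unfolding linear_form_def by (metis add_diff_cancel_right' diff_add_cancel)

lemma linear_form_cmul_nth_diff: "linear_form (\<lambda>x. a * x $ i - b * x $ j)"
  by (simp add: linear_form_def algebra_simps)

text \<open>Each \<open>x\<close> in \<open>A\<close> is uniquely \<open>z + t *s u\<close> with
  \<open>z\<close> in the kernel, namely for \<open>t = l x / l u\<close>. In the remarks below,
  \<open>q\<close> stands for the size of the field.\<close>

lemma card_ker_linear_form:
  fixes A :: "('a::{field,finite} ^ 'n) set"
  assumes A: "vec.subspace A" and l: "linear_form l" and u: "u \<in> A" "l u \<noteq> 0"
  shows "CARD('a) * card {x \<in> A. l x = 0} = card A"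
proof -
  define K where "K = {x \<in> A. l x = 0}"
  have "bij_betw (\<lambda>(t, z). z + t *s u) (UNIV \<times> K) A"
  proof (rule bij_betw_imageI)
    show "inj_on (\<lambda>(t, z). z + t *s u) (UNIV \<times> K)"
    proof (rule inj_onI, clarify)
      fix t z t' z' assume z: "z \<in> K" "z' \<in> K" and eq: "z + t *s u = z' + t' *s u"
      from eq have "l (z + t *s u) = l (z' + t' *s u)" by simp
      then have "t = t'" using z l u unfolding K_def linear_form_def by simp
      with eq show "t = t' \<and> z = z'" by simp
    qed
    show "(\<lambda>(t, z). z + t *s u) ` (UNIV \<times> K) = A"
    proof
      show "(\<lambda>(t, z). z + t *s u) ` (UNIV \<times> K) \<subseteq> A"
        using A u by (auto simp: K_def intro!: vec.subspace_add vec.subspace_scale)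
      show "A \<subseteq> (\<lambda>(t, z). z + t *s u) ` (UNIV \<times> K)"
      proof
        fix x assume x: "x \<in> A"
        let ?t = "l x / l u"
        have "l (x - ?t *s u) = 0"
          using l u by (simp add: linear_form_diff) (simp add: linear_form_def)
        then have "x - ?t *s u \<in> K"
          using A u x by (auto simp: K_def intro!: vec.subspace_diff vec.subspace_scale)
        then show "x \<in> (\<lambda>(t, z). z + t *s u) ` (UNIV \<times> K)"
          by (intro image_eqI[of _ _ "(?t, x - ?t *s u)"]) auto
      qed
    qed
  qed
  then have "card A = card ((UNIV :: 'a set) \<times> K)" by (simp add: bij_betw_same_card)
  then show ?thesis by (simp add: K_def card_cartesian_product)
qed

lemma card_span_independent:
  fixes B :: "('a::{field,finite} ^ 'n) set"
  assumes B: "vec.independent B"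
  shows "card (vec.span B) = CARD('a) ^ card B"
proof -
  have fin: "finite B" by simp
  have "bij_betw (\<lambda>g. \<Sum>b\<in>B. g b *s b) (B \<rightarrow>\<^sub>E (UNIV :: 'a set)) (vec.span B)"
  proof (rule bij_betw_imageI)
    show "inj_on (\<lambda>g. \<Sum>b\<in>B. g b *s b) (B \<rightarrow>\<^sub>E (UNIV :: 'a set))"
    proof (rule inj_onI)
      fix g h :: "'a ^ 'n \<Rightarrow> 'a"
      assume gh: "g \<in> B \<rightarrow>\<^sub>E UNIV" "h \<in> B \<rightarrow>\<^sub>E UNIV"
        and eq: "(\<Sum>b\<in>B. g b *s b) = (\<Sum>b\<in>B. h b *s b)"
      then have "(\<Sum>b\<in>B. (g b - h b) *s b) = 0"
        by (simp add: vec.scale_left_diff_distrib sum_subtractf)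
      then have "g b - h b = 0" if "b \<in> B" for b
        using vec.independentD[OF B fin, of "\<lambda>b. g b - h b" b] that by simp
      then show "g = h" using gh by (intro PiE_ext[of g B _ h]) auto
    qed
    show "(\<lambda>g. \<Sum>b\<in>B. g b *s b) ` (B \<rightarrow>\<^sub>E (UNIV :: 'a set)) = vec.span B"
    proof
      show "(\<lambda>g. \<Sum>b\<in>B. g b *s b) ` (B \<rightarrow>\<^sub>E (UNIV :: 'a set)) \<subseteq> vec.span B"
        by (auto intro!: vec.span_sum vec.span_scale intro: vec.span_base)
      show "vec.span B \<subseteq> (\<lambda>g. \<Sum>b\<in>B. g b *s b) ` (B \<rightarrow>\<^sub>E (UNIV :: 'a set))"
      proof
        fix x assume "x \<in> vec.span B"
        then obtain u where u: "x = (\<Sum>b\<in>B. u b *s b)"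
          using vec.span_finite[OF fin] by auto
        then have "x = (\<Sum>b\<in>B. (restrict u B) b *s b)" by simp
        then show "x \<in> (\<lambda>g. \<Sum>b\<in>B. g b *s b) ` (B \<rightarrow>\<^sub>E (UNIV :: 'a set))"
          by (intro image_eqI[of _ _ "restrict u B"]) auto
      qed
    qed
  qed
  from bij_betw_same_card[OF this] show ?thesis
    by (simp add: card_PiE[OF fin])
qed

lemma card_subspace:
  fixes A :: "('a::{field,finite} ^ 'n) set"
  assumes "vec.subspace A"
  shows "card A = CARD('a) ^ vec.dim A"
proof -
  obtain B where "B \<subseteq> A" "vec.independent B" "A \<subseteq> vec.span B" "card B = vec.dim A"
    using vec.basis_exists by blast
  then show ?thesis
    using card_span_independent[of B] assms by (metis vec.span_eq_iff vec.span_mono subset_antisym)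
qed

section \<open>Supports, shortened codes and hyperplanes\<close>

definition supp :: "('a::zero ^ 'n) set \<Rightarrow> 'n set"
  where "supp A = {i. \<exists>a\<in>A. a $ i \<noteq> 0}"

text \<open>The coordinate \<open>i\<close> is kept, so all subcodes stay in one ambient space. For
  \<open>i\<close> in \<open>supp A\<close> this is a hyperplane of \<open>A\<close>; coordinates
  with the same hyperplane are proportional on \<open>A\<close> and count as one projective point
  with multiplicity.\<close>

definition shorten :: "('a::zero ^ 'n) set \<Rightarrow> 'n \<Rightarrow> ('a ^ 'n) set"
  where "shorten A i = {a \<in> A. a $ i = 0}"

definition wt_on :: "'n set \<Rightarrow> 'a::zero ^ 'n \<Rightarrow> nat"
  where "wt_on I x = card {i \<in> I. x $ i \<noteq> 0}"

lemma subspace_shorten: "vec.subspace A \<Longrightarrow> vec.subspace (shorten A i)"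
  by (auto simp: vec.subspace_def shorten_def)

lemma card_shorten:
  fixes A :: "('a::{field,finite} ^ 'n) set"
  assumes "vec.subspace A" "i \<in> supp A"
  shows "CARD('a) * card (shorten A i) = card A"
  using assms card_ker_linear_form[OF assms(1) linear_form_nth]
  by (auto simp: supp_def shorten_def)

text \<open>Both hyperplanes have \<open>card A / q\<close> elements, so inclusion forces
  equality.\<close>

lemma shorten_subset_imp_eq:
  fixes A :: "('a::{field,finite} ^ 'n) set"
  assumes "vec.subspace A" "i \<in> supp A" "j \<in> supp A" "shorten A i \<subseteq> shorten A j"
  shows "shorten A i = shorten A j"
proof (rule card_subset_eq[OF _ assms(4)])
  show "card (shorten A i) = card (shorten A j)"
    using card_shorten[of A i] card_shorten[of A j] assms
    by (metis mult_left_cancel zero_less_card_finite less_not_refl2)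
qed simp

lemma supp_span: "supp (vec.span A) = supp (A :: ('a::field ^ 'n) set)"
proof
  have "x \<in> vec.span A \<Longrightarrow> x $ i = 0" if "i \<notin> supp A" for x i
    by (induction rule: vec.span_induct_alt) (use that in \<open>auto simp: supp_def\<close>)
  then show "supp (vec.span A) \<subseteq> supp A" by (auto simp: supp_def)
  show "supp A \<subseteq> supp (vec.span A)" by (auto simp: supp_def intro: vec.span_base)
qed

lemma supp_insert: "supp (insert y A) = {i. y $ i \<noteq> 0} \<union> supp A"
  by (auto simp: supp_def)

text \<open>A common divisor of the two support sizes thus divides the weight of \<open>y\<close>
  outside \<open>supp A\<close>, and conversely.\<close>

lemma card_supp_insert:
  "card (supp (insert y A)) = card (supp A) + wt_on (- supp A) (y :: 'a::zero ^ 'n::finite)"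
proof -
  have "supp (insert y A) = supp A \<union> {i \<in> - supp A. y $ i \<noteq> 0}"
    by (auto simp: supp_insert)
  then show ?thesis
    by (simp add: wt_on_def) (subst card_Un_disjoint, auto)
qed

lemma card_span_insert_le:
  fixes A :: "('a::{field,finite} ^ 'n) set"
  assumes "vec.subspace A"
  shows "card (vec.span (insert y A)) \<le> CARD('a) * card A"
proof -
  have "vec.span (insert y A) \<subseteq> (\<lambda>(t, a). a + t *s y) ` (UNIV \<times> A)"
  proof
    fix x assume "x \<in> vec.span (insert y A)"
    then obtain t where "x - t *s y \<in> vec.span A" by (auto simp: vec.span_insert)
    then have "x - t *s y \<in> A" using assms by (simp add: vec.span_eq_iff[THEN iffD2])
    then show "x \<in> (\<lambda>(t, a). a + t *s y) ` (UNIV \<times> A)"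
      by (intro image_eqI[of _ _ "(t, x - t *s y)"]) auto
  qed
  then have "card (vec.span (insert y A)) \<le> card ((\<lambda>(t, a). a + t *s y) ` (UNIV \<times> A))"
    by (intro card_mono) auto
  also have "\<dots> \<le> card ((UNIV :: 'a set) \<times> A)" by (intro card_image_le) auto
  finally show ?thesis by (simp add: card_cartesian_product)
qed

lemma geometric_sum_nat_times: "(q - 1) * (\<Sum>i<n. q ^ i) = q ^ n - (1 :: nat)"
proof (cases "q = 0")
  case False
  have "int (q - 1) * int (\<Sum>i<n. q ^ i) = int (q ^ n - 1)"
    using False power_diff_1_eq[of "int q" n] by (simp add: of_nat_diff Suc_leI)
  then show ?thesis by (metis of_nat_eq_iff of_nat_mult)
qed (cases n; simp)

text \<open>One coordinate per hyperplane together with a nonzero scalar gives a nonzero functional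
  on \<open>A\<close>. Different pairs give different functionals, and only
  \<open>q ^ dim A - 1\<close> of these exist; divide by \<open>q - 1\<close>.\<close>

lemma card_shorten_image_le:
  fixes A :: "('a::{field,finite} ^ 'n) set"
  assumes A: "vec.subspace A"
  shows "card (shorten A ` supp A) \<le> (\<Sum>i<vec.dim A. CARD('a) ^ i)"
proof -
  obtain B where B: "B \<subseteq> A" "vec.independent B" "A \<subseteq> vec.span B" "card B = vec.dim A"
    using vec.basis_exists by blast
  have fin: "finite B" by simp
  obtain T where T: "T \<subseteq> supp A" "inj_on (shorten A) T" "shorten A ` supp A = shorten A ` T"
    using subset_image_inj[of "shorten A ` supp A" "shorten A" "supp A"] by auto
  \<comment> \<open>The functional \<open>c * x $ i\<close> is recorded by its values on the basis
    \<open>B\<close>; \<open>zero\<close> recovers it on all of \<open>A\<close>.\<close>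
  define \<phi> :: "'n \<times> 'a \<Rightarrow> 'a ^ 'n \<Rightarrow> 'a" where "\<phi> = (\<lambda>(i, c). \<lambda>b\<in>B. c * b $ i)"
  have zero: "c * a $ i = d * a $ j"
    if "\<phi> (i, c) = \<phi> (j, d)" "a \<in> A" for i j c d a
  proof -
    have "a \<in> vec.span B" using B that by auto
    then show ?thesis
    proof (induction rule: vec.span_induct_alt)
      case base then show ?case by simp
    next
      case (step e x y)
      have "c * x $ i = d * x $ j"
        using fun_cong[OF that(1), of x] step(1) by (simp add: \<phi>_def)
      moreover have "c * (e * x $ i + y $ i) = e * (c * x $ i) + c * y $ i"
        "d * (e * x $ j + y $ j) = e * (d * x $ j) + d * y $ j"
        by (simp_all add: algebra_simps)
      ultimately show ?case using step by simp
    qed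
  qed
  let ?z = "\<lambda>b\<in>B. 0 :: 'a"
  have z: "?z = \<phi> (i, 0)" for i by (simp add: \<phi>_def restrict_def fun_eq_iff)
  have "card (T \<times> (UNIV - {0::'a})) \<le> card ((B \<rightarrow>\<^sub>E (UNIV :: 'a set)) - {?z})"
  proof (rule card_inj_on_le)
    show "inj_on \<phi> (T \<times> (UNIV - {0}))"
    proof (rule inj_onI)
      fix u v assume "u \<in> T \<times> (UNIV - {0::'a})" "v \<in> T \<times> (UNIV - {0::'a})" and uv: "\<phi> u = \<phi> v"
      then obtain i c j d where [simp]: "u = (i, c)" "v = (j, d)"
        and ij: "i \<in> T" "j \<in> T" and cd: "c \<noteq> 0" "d \<noteq> 0" by blast
      note eq = uv[simplified]
      have "shorten A i = shorten A j"
        using zero[OF eq] cd by (auto simp: shorten_def) (metis mult_eq_0_iff)+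
      then have "i = j" using T(2) ij by (auto dest: inj_onD)
      moreover obtain a where "a \<in> A" "a $ i \<noteq> 0" using T(1) ij by (auto simp: supp_def)
      ultimately show "u = v" using zero[OF eq, of a] by auto
    qed
    show "\<phi> ` (T \<times> (UNIV - {0})) \<subseteq> (B \<rightarrow>\<^sub>E (UNIV :: 'a set)) - {?z}"
    proof (rule image_subsetI)
      fix u assume "u \<in> T \<times> (UNIV - {0::'a})"
      then obtain i c where u: "u = (i, c)" and i: "i \<in> T" and c: "c \<noteq> 0" by blast
      obtain a where "a \<in> A" "a $ i \<noteq> 0" using T(1) i by (auto simp: supp_def)
      then have "\<phi> (i, c) \<noteq> ?z" using zero[of i c i 0 a] c z[of i] by auto
      moreover have "\<phi> (i, c) \<in> B \<rightarrow>\<^sub>E UNIV" by (simp add: \<phi>_def)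
      ultimately show "\<phi> u \<in> (B \<rightarrow>\<^sub>E (UNIV :: 'a set)) - {?z}"
        unfolding u by (intro DiffI) simp_all
    qed
    show "finite ((B \<rightarrow>\<^sub>E (UNIV :: 'a set)) - {?z})" by (simp add: finite_PiE)
  qed
  also have "\<dots> = CARD('a) ^ vec.dim A - 1"
    using B(4) by (simp add: card_PiE[OF fin] finite_PiE)
  finally have "card T * (CARD('a) - 1) \<le> (\<Sum>i<vec.dim A. CARD('a) ^ i) * (CARD('a) - 1)"
    using geometric_sum_nat_times[of "CARD('a)" "vec.dim A"]
    by (simp add: card_cartesian_product card_Diff_subset mult.commute)
  moreover have "CARD('a) - 1 > 0"
    using CARD_field_gt_1[where 'a = 'a] by linarith
  ultimately show ?thesis using T by (simp add: card_image)
qed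

subsection \<open>Weights in pencils and the Griesmer bound\<close>

lemma card_filter_eq_sum:
  "finite I \<Longrightarrow> card {i \<in> I. P i} = (\<Sum>i\<in>I. if P i then 1 else 0)"
  by (simp add: sum.inter_filter[symmetric])

text \<open>The pencil consists of \<open>x\<close> and the \<open>q\<close> words
  \<open>y - t *s x\<close>. Where \<open>x\<close> is nonzero, exactly one of these
  \<open>q + 1\<close> words vanishes; where only \<open>y\<close> is nonzero, only \<open>x\<close>
  vanishes. So each coordinate in the support of the pencil is counted \<open>q\<close>
  times.\<close>

lemma pencil_wt:
  fixes x y :: "'a::{field,finite} ^ 'n"
  shows "(\<Sum>t\<in>UNIV. wt_on I (y - t *s x)) + wt_on I x
    = CARD('a) * card {i \<in> I. x $ i \<noteq> 0 \<or> y $ i \<noteq> 0}"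
proof -
  have fin: "finite I" by simp
  have wt: "wt_on I z = (\<Sum>i\<in>I. if z $ i \<noteq> 0 then 1 else 0)" for z :: "'a ^ 'n"
    by (simp only: wt_on_def card_filter_eq_sum[OF fin])
  have pt: "(\<Sum>t\<in>UNIV. if (y - t *s x) $ i \<noteq> 0 then 1 else 0) + (if x $ i \<noteq> 0 then 1 else 0)
      = (if x $ i \<noteq> 0 \<or> y $ i \<noteq> 0 then CARD('a) else 0)" for i
  proof -
    have "(\<Sum>t\<in>UNIV. if (y - t *s x) $ i \<noteq> 0 then 1 else 0) = card {t. y $ i \<noteq> t * x $ i}"
      using card_filter_eq_sum[of "UNIV :: 'a set" "\<lambda>t. y $ i \<noteq> t * x $ i"] by simp
    moreover have "{t. y $ i \<noteq> t * x $ i} = UNIV - {y $ i / x $ i}" if "x $ i \<noteq> 0"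
      using that by (auto simp: field_simps)
    moreover have "CARD('a) > 0" by simp
    ultimately show ?thesis by (cases "x $ i = 0") (auto simp: card_Diff_subset)
  qed
  have "(\<Sum>t\<in>UNIV. wt_on I (y - t *s x)) + wt_on I x
      = (\<Sum>i\<in>I. (\<Sum>t\<in>UNIV. if (y - t *s x) $ i \<noteq> 0 then 1 else 0) + (if x $ i \<noteq> 0 then 1 else 0))"
    unfolding wt sum.distrib by (subst sum.swap) simp
  also have "\<dots> = (\<Sum>i\<in>I. if x $ i \<noteq> 0 \<or> y $ i \<noteq> 0 then CARD('a) else 0)"
    by (simp only: pt)
  also have "\<dots> = CARD('a) * card {i \<in> I. x $ i \<noteq> 0 \<or> y $ i \<noteq> 0}"
    by (simp add: sum.inter_filter[OF fin, symmetric])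
  finally show ?thesis .
qed

text \<open>Double counting: a coordinate in \<open>supp A\<close> is nonzero on a fraction
  \<open>(q - 1) / q\<close> of the words.\<close>

lemma sum_wt_subspace:
  fixes A :: "('a::{field,finite} ^ 'n) set"
  assumes A: "vec.subspace A"
  shows "CARD('a) * (\<Sum>x\<in>A. wt_on UNIV x) = card A * (CARD('a) - 1) * card (supp A)"
proof -
  have fin: "finite A" by simp
  have "(\<Sum>x\<in>A. wt_on UNIV x) = (\<Sum>x\<in>A. \<Sum>i\<in>UNIV. if x $ i \<noteq> 0 then 1 else 0)"
    using card_filter_eq_sum[of "UNIV :: 'n set"] by (simp add: wt_on_def)
  also have "\<dots> = (\<Sum>i\<in>UNIV. \<Sum>x\<in>A. if x $ i \<noteq> 0 then 1 else 0)"
    by (rule sum.swap)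
  also have "\<dots> = (\<Sum>i\<in>UNIV. card {x \<in> A. x $ i \<noteq> 0})"
    by (simp only: card_filter_eq_sum[OF fin])
  also have "\<dots> = (\<Sum>i\<in>supp A. card {x \<in> A. x $ i \<noteq> 0})"
    by (rule sum.mono_neutral_right) (auto simp: supp_def)
  finally have "CARD('a) * (\<Sum>x\<in>A. wt_on UNIV x) = (\<Sum>i\<in>supp A. CARD('a) * card {x \<in> A. x $ i \<noteq> 0})"
    by (simp add: sum_distrib_left)
  also have "\<dots> = (\<Sum>i\<in>supp A. card A * (CARD('a) - 1))"
  proof (rule sum.cong)
    fix i assume i: "i \<in> supp A"
    have "{x \<in> A. x $ i \<noteq> 0} = A - shorten A i" by (auto simp: shorten_def)
    then have "card {x \<in> A. x $ i \<noteq> 0} = card A - card (shorten A i)"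
      by (simp add: card_Diff_subset shorten_def)
    then show "CARD('a) * card {x \<in> A. x $ i \<noteq> 0} = card A * (CARD('a) - 1)"
      using card_shorten[OF A i] by (simp add: diff_mult_distrib2 mult.commute)
  qed simp
  finally show ?thesis by simp
qed

section \<open>The Griesmer bound for subspaces\<close>

lemma griesmer_bound_Suc:
  "griesmer_bound q (Suc k) d = d + (\<Sum>i<k. nat \<lceil>real d / real q ^ Suc i\<rceil>)"
  unfolding griesmer_bound_def sum.lessThan_Suc_shift by simp

lemma griesmer_bound_residual:
  assumes "d \<le> q * d'" "q > 0"
  shows "griesmer_bound q (Suc k) d \<le> d + griesmer_bound q k d'"
proof -
  have "nat \<lceil>real d / real q ^ Suc i\<rceil> \<le> nat \<lceil>real d' / real q ^ i\<rceil>" for i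
  proof -
    have "real d \<le> real q * real d'" using assms(1) by (metis of_nat_le_iff of_nat_mult)
    then have "real d / real q ^ Suc i \<le> real d' / real q ^ i"
      using assms(2) by (simp add: field_simps)
    then show ?thesis by (intro nat_mono ceiling_mono)
  qed
  then show ?thesis unfolding griesmer_bound_Suc by (simp add: griesmer_bound_def sum_mono)
qed

text \<open>Working relative to a set \<open>I\<close> of coordinates keeps residual codes inside the same
  ambient space: the residual of \<open>C\<close> at \<open>c\<close> is any hyperplane avoiding \<open>c\<close>, read off outside the
  support of \<open>c\<close>.\<close>

lemma griesmer_bound_on:
  fixes C :: "('a::{field,finite} ^ 'n) set"
  assumes "vec.subspace C" "card C = CARD('a) ^ k" "d \<ge> 1"
    and "\<And>c. c \<in> C \<Longrightarrow> c \<noteq> 0 \<Longrightarrow> d \<le> wt_on I c"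
  shows "griesmer_bound CARD('a) k d \<le> card (I \<inter> supp C)"
  using assms
proof (induction k arbitrary: C d I)
  case 0
  then show ?case by (simp add: griesmer_bound_def)
next
  case (Suc k)
  let ?q = "CARD('a)"
  have q: "?q > 1" by (rule CARD_field_gt_1)
  have "C \<noteq> {0}" using Suc.prems(2) q by (metis card.empty card_insert_disjoint empty_iff finite.emptyI
      less_numeral_extra(4) one_less_power zero_less_Suc One_nat_def)
  then obtain c0 where "c0 \<in> C - {0}" using vec.subspace_0[OF Suc.prems(1)] by auto
  then obtain c where c: "c \<in> C - {0}" and min: "\<And>x. x \<in> C - {0} \<Longrightarrow> wt_on I c \<le> wt_on I x"
    using ex_has_least_nat[of "\<lambda>x. x \<in> C - {0}" c0 "wt_on I"] by blast
  define w where "w = wt_on I c"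
  have w: "d \<le> w" using Suc.prems(4) c by (auto simp: w_def)
  then have "card {i \<in> I. c $ i \<noteq> 0} > 0" using Suc.prems(3) by (simp add: w_def wt_on_def)
  then obtain j where j: "c $ j \<noteq> 0" unfolding card_gt_0_iff by blast
  define D where "D = shorten C j"
  define J where "J = {i \<in> I. c $ i = 0}"
  define d' where "d' = nat \<lceil>real d / real ?q\<rceil>"
  have D: "vec.subspace D" using Suc.prems(1) by (simp add: D_def subspace_shorten)
  have "j \<in> supp C" using j c by (auto simp: supp_def)
  then have "?q * card D = ?q * ?q ^ k"
    using card_shorten[OF Suc.prems(1)] Suc.prems(2) by (simp add: D_def)
  then have cardD: "card D = ?q ^ k" by simp
  \<comment> \<open>The \<open>q + 1\<close> words of the pencil of \<open>c\<close> and
    \<open>x\<close> are nonzero and have weight at least \<open>w\<close> on \<open>I\<close>. Its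
    support on \<open>I\<close> has size \<open>w + wt_on J x\<close>, so \<open>pencil_wt\<close>
    gives \<open>w \<le> q * wt_on J x\<close>.\<close>
  have res: "d \<le> ?q * wt_on J x" if x: "x \<in> D" "x \<noteq> 0" for x
  proof -
    have "w \<le> wt_on I (x - t *s c)" for t
    proof -
      have "x - t *s c \<in> C"
        using x c Suc.prems(1) by (auto simp: D_def shorten_def intro!: vec.subspace_diff vec.subspace_scale)
      moreover have "x - t *s c \<noteq> 0"
      proof
        assume eq: "x - t *s c = 0"
        then have "(x - t *s c) $ j = 0" by simp
        then have "t = 0" using x j by (simp add: D_def shorten_def)
        then show False using eq x by simp
      qed
      ultimately show ?thesis using min by (simp add: w_def)
    qed
    then have "(\<Sum>t\<in>(UNIV :: 'a set). w) \<le> (\<Sum>t\<in>UNIV. wt_on I (x - t *s c))" by (intro sum_mono)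
    then have "?q * w + w \<le> ?q * card {i \<in> I. c $ i \<noteq> 0 \<or> x $ i \<noteq> 0}"
      using pencil_wt[of I x c] by (simp add: w_def)
    also have "{i \<in> I. c $ i \<noteq> 0 \<or> x $ i \<noteq> 0} = {i \<in> I. c $ i \<noteq> 0} \<union> {i \<in> J. x $ i \<noteq> 0}"
      by (auto simp: J_def)
    also have "card \<dots> = w + wt_on J x"
      unfolding w_def wt_on_def by (rule card_Un_disjoint) (auto simp: J_def)
    finally show ?thesis using w by (simp add: algebra_simps)
  qed
  have "griesmer_bound ?q k d' \<le> card (J \<inter> supp D)"
  proof (rule Suc.IH[OF D cardD])
    have "0 < real d / real ?q" using Suc.prems(3) by simp
    then show "1 \<le> d'" unfolding d'_def by linarith
    show "d' \<le> wt_on J x" if "x \<in> D" "x \<noteq> 0" for x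
    proof -
      have "real d \<le> real ?q * real (wt_on J x)" using res[OF that] by (metis of_nat_le_iff of_nat_mult)
      then have "real d / real ?q \<le> real (wt_on J x)" using q by (simp add: field_simps)
      then show ?thesis by (simp add: d'_def ceiling_le_iff)
    qed
  qed
  moreover have "d \<le> ?q * d'"
  proof -
    have "real d / real ?q \<le> real d'" unfolding d'_def by linarith
    then have "real d \<le> real (?q * d')" using q by (simp add: field_simps)
    then show ?thesis by linarith
  qed
  ultimately have "griesmer_bound ?q (Suc k) d \<le> w + card (J \<inter> supp D)"
    using griesmer_bound_residual[of d ?q d' k] q w by linarith
  also have "\<dots> = card ({i \<in> I. c $ i \<noteq> 0} \<union> (J \<inter> supp D))"
    unfolding w_def wt_on_def by (rule card_Un_disjoint[symmetric]) (auto simp: J_def)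
  also have "\<dots> \<le> card (I \<inter> supp C)"
    using c by (intro card_mono) (auto simp: J_def D_def shorten_def supp_def)
  finally show ?case .
qed

subsection \<open>Polynomial functions vanishing on hyperplanes\<close>

text \<open>Polynomial functions with \<open>r\<close> as an upper bound for the total degree:
  constants occur at every \<open>r\<close>, and each linear factor raises the bound by one.
  Inductions can so peel off linear factors without handling monomials.\<close>

inductive poly_fun :: "nat \<Rightarrow> ('a::field ^ 'n \<Rightarrow> 'a) \<Rightarrow> bool" where
  const: "poly_fun r (\<lambda>_. c)"
| add: "poly_fun r g \<Longrightarrow> poly_fun r h \<Longrightarrow> poly_fun r (\<lambda>x. g x + h x)"
| mult: "linear_form l \<Longrightarrow> poly_fun r g \<Longrightarrow> poly_fun (Suc r) (\<lambda>x. l x * g x)"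

lemma poly_fun_0: "poly_fun 0 h \<Longrightarrow> \<exists>c. \<forall>x. h x = c"
proof (induction "0 :: nat" h rule: poly_fun.induct)
  case (add g h)
  then show ?case by metis
qed auto

lemma poly_fun_cmult: "poly_fun r h \<Longrightarrow> poly_fun r (\<lambda>x. c * h x)"
proof (induction rule: poly_fun.induct)
  case (mult l r g)
  then have "poly_fun (Suc r) (\<lambda>x. l x * (c * g x))" by (auto intro: poly_fun.intros)
  then show ?case by (simp add: mult.left_commute)
qed (auto simp: distrib_left intro: poly_fun.intros)

lemma poly_fun_sum: "(\<And>i. i \<in> S \<Longrightarrow> poly_fun r (h i)) \<Longrightarrow> poly_fun r (\<lambda>x. \<Sum>i\<in>S. h i x)"
  by (induction S rule: infinite_finite_induct) (auto intro: poly_fun.intros)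

lemma poly_fun_power: "linear_form l \<Longrightarrow> poly_fun r (\<lambda>x. l x ^ r)"
  by (induction r) (auto intro: poly_fun.intros)

lemma poly_fun_comp:
  assumes "poly_fun r h" "\<And>x y. \<pi> (x + y) = \<pi> x + \<pi> y" "\<And>c x. \<pi> (c *s x) = c *s \<pi> x"
  shows "poly_fun r (\<lambda>x. h (\<pi> x))"
  using assms(1)
proof (induction rule: poly_fun.induct)
  case (mult l r g)
  then have "linear_form (\<lambda>x. l (\<pi> x))" by (simp add: linear_form_def assms)
  with mult show ?case by (auto intro: poly_fun.mult)
qed (auto intro: poly_fun.intros)

lemma poly_fun_line:
  assumes "poly_fun r h"
  shows "\<exists>P. degree P \<le> r \<and> (\<forall>t. h (z + t *s v) = poly P t)"
  using assms
proof (induction rule: poly_fun.induct)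
  case (const r c)
  show ?case by (rule exI[of _ "[:c:]"]) simp
next
  case (add r g h)
  then obtain P Q where "degree P \<le> r" "\<forall>t. g (z + t *s v) = poly P t"
    "degree Q \<le> r" "\<forall>t. h (z + t *s v) = poly Q t" by blast
  then show ?case by (intro exI[of _ "P + Q"]) (simp add: degree_add_le)
next
  case (mult l r g)
  then obtain P where P: "degree P \<le> r" "\<forall>t. g (z + t *s v) = poly P t" by blast
  have "degree ([:l z, l v:] * P) \<le> degree [:l z, l v:] + degree P" by (rule degree_mult_le)
  also have "degree [:l z, l v:] \<le> 1" by simp
  finally have "degree ([:l z, l v:] * P) \<le> Suc r" using P by simp
  then show ?case
    using P mult(1) by (intro exI[of _ "[:l z, l v:] * P"]) (simp add: linear_form_def algebra_simps)
qed

text \<open>If \<open>l u = 1\<close>, then \<open>x - l x *s u\<close> is the projection to the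
  kernel of \<open>l\<close> along \<open>u\<close>, so a function vanishing on the kernel is
  \<open>l\<close> times one of lower degree. The induction uses the product rule for
  differences.\<close>

lemma poly_fun_divide:
  assumes "poly_fun (Suc r) h" "linear_form l"
  shows "\<exists>g. poly_fun r g \<and> (\<forall>x. h x - h (x - l x *s u) = l x * g x)"
  using assms
proof (induction "Suc r" h arbitrary: r rule: poly_fun.induct)
  case (const c)
  show ?case by (intro exI[of _ "\<lambda>_. 0"]) (auto intro: poly_fun.const)
next
  case (add h1 h2)
  then obtain g1 g2 where g: "poly_fun r g1" "\<And>x. h1 x - h1 (x - l x *s u) = l x * g1 x"
    "poly_fun r g2" "\<And>x. h2 x - h2 (x - l x *s u) = l x * g2 x" by metis
  show ?case
  proof (intro exI[of _ "\<lambda>x. g1 x + g2 x"] conjI allI)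
    show "h1 x + h2 x - (h1 (x - l x *s u) + h2 (x - l x *s u)) = l x * (g1 x + g2 x)" for x
      unfolding distrib_left g(2)[symmetric] g(4)[symmetric] by simp
  qed (use g in \<open>auto intro: poly_fun.add\<close>)
next
  case (mult m r h)
  let ?\<pi> = "\<lambda>x. x - l x *s u"
  have lin: "?\<pi> (x + y) = ?\<pi> x + ?\<pi> y" "?\<pi> (c *s x) = c *s ?\<pi> x" for x y c
    using mult.prems by (simp_all add: linear_form_def vec_eq_iff algebra_simps)
  have m: "m x - m (?\<pi> x) = l x * m u" for x
    using mult(1) linear_form_diff[OF mult(1)] by (simp add: linear_form_def)
  \<comment> \<open>The bound is put on \<open>m x * g x\<close> to cover \<open>r = 0\<close>,
    where \<open>h\<close> is constant and \<open>g\<close> is zero.\<close>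
  obtain g where g: "poly_fun r (\<lambda>x. m x * g x)" "\<And>x. h x - h (?\<pi> x) = l x * g x"
  proof (cases r)
    case 0
    obtain c where "\<And>x. h x = c" using poly_fun_0 mult(2) 0 by blast
    then show ?thesis by (intro that[of "\<lambda>_. 0"]) (auto intro: poly_fun.const)
  next
    case (Suc r')
    then obtain g where "poly_fun r' g" "\<And>x. h x - h (?\<pi> x) = l x * g x"
      using mult by metis
    then show ?thesis using Suc mult(1) by (intro that[of g]) (auto intro: poly_fun.mult)
  qed
  show ?case
  proof (intro exI[of _ "\<lambda>x. m u * h (?\<pi> x) + m x * g x"] conjI allI)
    show "poly_fun r (\<lambda>x. m u * h (?\<pi> x) + m x * g x)"
      using poly_fun_comp[OF mult(2), of ?\<pi>] lin g(1) by (intro poly_fun.add poly_fun_cmult) auto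
    fix x
    have "m x * h x - m (?\<pi> x) * h (?\<pi> x) = m x * (h x - h (?\<pi> x)) + (m x - m (?\<pi> x)) * h (?\<pi> x)"
      by (rule mult_diff_mult)
    also have "\<dots> = l x * (m u * h (?\<pi> x) + m x * g x)"
      unfolding m g(2) distrib_left by (simp only: mult.assoc mult.left_commute add.commute)
    finally show "m x * h x - m (?\<pi> x) * h (?\<pi> x) = l x * (m u * h (?\<pi> x) + m x * g x)" .
  qed
qed

text \<open>Induction on the degree: on \<open>C\<close>, \<open>h\<close> is the coordinate
  \<open>j\<close> times a quotient of smaller degree, and that quotient vanishes on the remaining
  hyperplanes. In degree 0 the value at the zero word decides.\<close>

lemma poly_fun_vanish:
  fixes C :: "('a::{field,finite} ^ 'n) set"
  assumes "poly_fun r h" "r < CARD('a)" "vec.subspace C" "T \<subseteq> supp C" "inj_on (shorten C) T"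
    "card T > r" "\<And>i c. i \<in> T \<Longrightarrow> c \<in> shorten C i \<Longrightarrow> h c = 0" "x \<in> C"
  shows "h x = 0"
  using assms
proof (induction r arbitrary: h T x)
  case 0
  obtain c where c: "\<And>x. h x = c" using poly_fun_0 0(1) by blast
  obtain i where i: "i \<in> T" using 0(6) by (metis card.empty ex_in_conv less_irrefl)
  have "0 \<in> shorten C i" using 0(3) by (simp add: shorten_def vec.subspace_0)
  then have "h 0 = 0" by (rule 0(7)[OF i])
  then show ?case by (simp only: c)
next
  case (Suc r)
  have C: "vec.subspace C" by fact
  obtain j where j: "j \<in> T" using Suc.prems(6) by (metis card.empty ex_in_conv not_less_zero)
  then obtain u0 where u0: "u0 \<in> C" "u0 $ j \<noteq> 0" using Suc.prems(4) by (auto simp: supp_def)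
  \<comment> \<open>Normalised so that \<open>y - y $ j *s u\<close> projects \<open>C\<close> to
    \<open>shorten C j\<close>, where \<open>h\<close> vanishes.\<close>
  define u where "u = (1 / u0 $ j) *s u0"
  have u: "u \<in> C" "u $ j = 1" using u0 C by (auto simp: u_def vec.subspace_scale)
  obtain g where g: "poly_fun r g" "\<And>x. h x - h (x - x $ j *s u) = x $ j * g x"
    using poly_fun_divide[OF Suc.prems(1) linear_form_nth[of j], of u] by blast
  have hg: "h y = y $ j * g y" if "y \<in> C" for y
  proof -
    have "y - y $ j *s u \<in> shorten C j"
      using that u C by (auto simp: shorten_def intro!: vec.subspace_diff vec.subspace_scale)
    then have "h (y - y $ j *s u) = 0" by (rule Suc.prems(7)[OF j])
    then show ?thesis using g(2)[of y] by (simp only: diff_zero)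
  qed
  have "g x = 0"
  proof (rule Suc.IH[OF g(1), of "T - {j}" x])
    fix i c assume i: "i \<in> T - {j}" and c: "c \<in> shorten C i"
    have "shorten C i \<noteq> shorten C j" using i j Suc.prems(5) by (auto dest: inj_onD)
    then have "\<not> shorten C i \<subseteq> shorten C j"
      using shorten_subset_imp_eq[OF C] i j Suc.prems(4) by blast
    then obtain v where v: "v \<in> shorten C i" "v $ j \<noteq> 0" by (auto simp: shorten_def)
    have zero: "g y = 0" if "y \<in> shorten C i" "y $ j \<noteq> 0" for y
    proof -
      have "h y = 0" using Suc.prems(7)[of i y] that i by blast
      moreover have "y \<in> C" using that(1) by (simp add: shorten_def)
      ultimately show ?thesis using hg[of y] that(2) by simp
    qed
    show "g c = 0"
    proof (cases "c $ j = 0")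
      case True
      \<comment> \<open>For \<open>c $ j = 0\<close> the factor \<open>c $ j\<close> hides
        \<open>g c\<close>. Along the line through \<open>c\<close> in direction \<open>v\<close>,
        \<open>g\<close> is a polynomial of degree at most \<open>r < q - 1\<close> with all
        \<open>q - 1\<close> nonzero \<open>t\<close> as roots, hence zero also at
        \<open>t = 0\<close>.\<close>
      obtain P where P: "degree P \<le> r" "\<And>t. g (c + t *s v) = poly P t"
        using poly_fun_line[OF g(1), of c v] by blast
      have "poly P t = 0" if "t \<noteq> 0" for t
      proof -
        have "c + t *s v \<in> shorten C i"
          using c v subspace_shorten[OF C] by (auto intro!: vec.subspace_add vec.subspace_scale)
        moreover have "(c + t *s v) $ j \<noteq> 0" using True v that by simp
        ultimately show ?thesis using zero P(2) by metis
      qed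
      then have sub: "UNIV - {0} \<subseteq> {t. poly P t = 0}" by auto
      have "P = 0"
      proof (rule ccontr)
        assume P0: "P \<noteq> 0"
        have "CARD('a) - 1 = card (UNIV - {0 :: 'a})" by simp
        also have "\<dots> \<le> card {t. poly P t = 0}" by (intro card_mono sub) simp
        also have "\<dots> \<le> r" using card_poly_roots_bound[OF P0] P(1) by linarith
        finally show False using Suc.prems(2) by simp
      qed
      then show ?thesis using P(2)[of 0] by simp
    qed (rule zero[OF c])
  next
    show "inj_on (shorten C) (T - {j})" using Suc.prems(5) by (rule inj_on_subset) blast
    show "T - {j} \<subseteq> supp C" using Suc.prems(4) by blast
    show "r < card (T - {j})" using Suc.prems(6) j by simp
  qed (use Suc.prems(2,8) C in simp_all)
  with hg[OF Suc.prems(8)] show ?case by simp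
qed

section \<open>Weights modulo the characteristic\<close>

lemma finite_field_power_pred_card:
  fixes x :: "'a::{field,finite}"
  assumes "x \<noteq> 0"
  shows "x ^ (CARD('a) - 1) = 1"
proof -
  have "(\<Prod>y\<in>UNIV - {0}. x * y) = \<Prod>(UNIV - {0})"
    by (rule prod.reindex_bij_witness[of _ "\<lambda>y. y / x" "\<lambda>y. x * y"]) (use assms in auto)
  then have "x ^ (CARD('a) - 1) * \<Prod>(UNIV - {0}) = 1 * \<Prod>(UNIV - {0})"
    by (simp add: prod.distrib)
  then show ?thesis by (subst (asm) mult_right_cancel) auto
qed

text \<open>The power is the indicator of a nonzero entry. Modulo \<open>p\<close> the weight is
  therefore a polynomial function of degree at most \<open>q - 1\<close>.\<close>

lemma of_nat_wt_on:
  fixes x :: "'a::{field,finite} ^ 'n"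
  shows "of_nat (wt_on I x) = (\<Sum>i\<in>I. (x $ i) ^ (CARD('a) - 1))"
proof -
  have "(x $ i) ^ (CARD('a) - 1) = (if x $ i \<noteq> 0 then 1 else 0)" for i
    using finite_field_power_pred_card[of "x $ i"] CARD_field_gt_1[where 'a = 'a]
    by (auto simp: power_0_left)
  then show ?thesis by (simp add: wt_on_def sum.inter_filter[symmetric])
qed

lemma poly_fun_wt_on:
  "poly_fun (CARD('a) - 1) (\<lambda>x :: 'a::{field,finite} ^ 'n. of_nat (wt_on I x))"
  unfolding of_nat_wt_on by (intro poly_fun_sum poly_fun_power linear_form_nth)

text \<open>The characteristic is a prime dividing \<open>p ^ f\<close>, hence \<open>p\<close>
  itself.\<close>

lemma of_nat_eq_0_iff_dvd_prime:
  assumes "prime p" "CARD('a::{field,finite}) = p ^ f"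
  shows "of_nat n = (0 :: 'a) \<longleftrightarrow> p dvd n"
proof -
  have "CHAR('a) dvd p ^ f" using CHAR_dvd_CARD[where 'a = 'a] assms by simp
  moreover from this have "CHAR('a) > 0"
    using assms by (metis dvd_0_left_iff gr0I power_not_zero prime_gt_0_nat less_irrefl)
  ultimately have "CHAR('a) = p"
    using prime_CHAR_semidom[where 'a = 'a] assms(1) prime_dvd_power primes_dvd_imp_eq by blast
  then show ?thesis by (simp add: of_nat_eq_0_iff_char_dvd)
qed

subsection \<open>Hyperplanes meeting every point of a pencil\<close>

lemma pigeonhole_fibre:
  assumes "finite S" "card (\<phi> ` S) * b < card S"
  shows "\<exists>z\<in>\<phi> ` S. b < card {s \<in> S. \<phi> s = z}"
proof (rule ccontr)
  assume "\<not> ?thesis"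
  then have "(\<Sum>z\<in>\<phi> ` S. card {s \<in> S. \<phi> s = z}) \<le> (\<Sum>z\<in>\<phi> ` S. b)"
    by (intro sum_mono) (auto simp: not_less)
  moreover have "card S = (\<Sum>z\<in>\<phi> ` S. card {s \<in> S. \<phi> s = z})"
    using sum.image_gen[OF assms(1), of "\<lambda>_. 1 :: nat" \<phi>] by simp
  ultimately show False using assms(2) by simp
qed

text \<open>Second moment argument: on average the values \<open>y $ i / x $ i\<close> collide as rarely as those of
  a random function, whereas a function missing a value has too many collisions.\<close>

lemma exists_all_ratios:
  fixes C :: "('a::{field,finite} ^ 'n) set"
  assumes C: "vec.subspace C" and T: "inj_on (shorten C) T" "card T > (CARD('a) - 1)\<^sup>2"
    and x: "x \<in> C" "\<And>i. i \<in> T \<Longrightarrow> x $ i \<noteq> 0"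
  shows "\<exists>y\<in>C. \<forall>t. \<exists>i\<in>T. y $ i = t * x $ i"
proof (rule ccontr)
  assume neg: "\<not> ?thesis"
  define q where "q = CARD('a)"
  have q: "q > 1" unfolding q_def by (rule CARD_field_gt_1)
  define N where "N = card T"
  have fin: "finite T" "finite C" by simp_all
  have supp: "T \<subseteq> supp C" using x by (auto simp: supp_def)
  have N0: "N > 0" using T(2) by (simp add: N_def)
  define E where "E y = card {(i, j) \<in> T \<times> T. y $ i / x $ i = y $ j / x $ j}" for y :: "'a ^ 'n"
  \<comment> \<open>The \<open>N\<close> ratios of \<open>y\<close> miss a value \<open>t0\<close>,
    so they are spread over at most \<open>q - 1\<close> values; Cauchy-Schwarz bounds the number
    \<open>E y\<close> of colliding pairs from below.\<close>
  have lower: "N\<^sup>2 \<le> (q - 1) * E y" if y: "y \<in> C" for y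
  proof -
    define n where "n t = card {i \<in> T. y $ i / x $ i = t}" for t
    obtain t0 where t0: "\<And>i. i \<in> T \<Longrightarrow> y $ i \<noteq> t0 * x $ i" using neg y by blast
    have n0: "n t0 = 0"
    proof -
      have "{i \<in> T. y $ i / x $ i = t0} = {}" using t0 x(2) by (auto simp: field_simps)
      then show ?thesis by (simp add: n_def)
    qed
    have "N = (\<Sum>t\<in>UNIV. n t)"
      using sum.group[of T UNIV "\<lambda>i. y $ i / x $ i" "\<lambda>_. 1 :: nat"] by (simp add: n_def N_def)
    then have sum_n: "N = (\<Sum>t\<in>UNIV - {t0}. n t)" using n0 by (simp add: sum.remove[of UNIV t0])
    have "E y = (\<Sum>t\<in>UNIV. n t * n t)"
    proof -
      have "{(i, j) \<in> T \<times> T. y $ i / x $ i = y $ j / x $ j}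
          = (\<Union>t\<in>UNIV. {i \<in> T. y $ i / x $ i = t} \<times> {i \<in> T. y $ i / x $ i = t})" by auto
      then have "E y = card (\<Union>t\<in>UNIV. {i \<in> T. y $ i / x $ i = t} \<times> {i \<in> T. y $ i / x $ i = t})"
        by (simp add: E_def)
      also have "\<dots> = (\<Sum>t\<in>UNIV. card ({i \<in> T. y $ i / x $ i = t} \<times> {i \<in> T. y $ i / x $ i = t}))"
        by (intro card_UN_disjoint) auto
      finally show ?thesis by (simp add: n_def card_cartesian_product)
    qed
    then have E: "E y = (\<Sum>t\<in>UNIV - {t0}. (n t)\<^sup>2)"
      using n0 by (simp add: sum.remove[of UNIV t0] power2_eq_square)
    have "(\<Sum>t\<in>UNIV - {t0}. real (n t))\<^sup>2 \<le> (\<Sum>t\<in>UNIV - {t0}. (real (n t))\<^sup>2) * card (UNIV - {t0})"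
      by (rule sum_squared_le_sum_of_squares)
    then have "real (N\<^sup>2) \<le> real (E y * (q - 1))"
      unfolding sum_n E by (simp add: q_def)
    then show ?thesis by (simp only: of_nat_le_iff mult.commute)
  qed
  \<comment> \<open>For different \<open>i\<close> and \<open>j\<close> a collision is one
    nontrivial linear condition on \<open>y\<close>, satisfied by a fraction \<open>1 / q\<close> of
    the words of \<open>C\<close>.\<close>
  have pairs: "q * card {y \<in> C. y $ i / x $ i = y $ j / x $ j} = (if i = j then q else 1) * card C"
    if ij: "i \<in> T" "j \<in> T" for i j
  proof (cases "i = j")
    case False
    have "shorten C i \<noteq> shorten C j" using False ij T(1) by (auto dest: inj_onD)
    then have "\<not> shorten C i \<subseteq> shorten C j"
      using shorten_subset_imp_eq[OF C] ij supp by blast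
    then obtain u where u: "u \<in> C" "u $ i = 0" "u $ j \<noteq> 0" by (auto simp: shorten_def)
    have "{y \<in> C. y $ i / x $ i = y $ j / x $ j} = {y \<in> C. x $ j * y $ i - x $ i * y $ j = 0}"
      using x(2) ij by (auto simp: field_simps)
    then show ?thesis
      using card_ker_linear_form[OF C linear_form_cmul_nth_diff[of "x $ j" i "x $ i" j] u(1)] u x(2) ij False
      by (simp add: q_def)
  qed simp
  have "(\<Sum>y\<in>C. E y) = (\<Sum>y\<in>C. \<Sum>(i, j)\<in>T \<times> T. if y $ i / x $ i = y $ j / x $ j then 1 else 0)"
  proof (rule sum.cong)
    fix y
    have "{(i, j) \<in> T \<times> T. y $ i / x $ i = y $ j / x $ j}
        = {u \<in> T \<times> T. y $ fst u / x $ fst u = y $ snd u / x $ snd u}" by auto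
    then show "E y = (\<Sum>(i, j)\<in>T \<times> T. if y $ i / x $ i = y $ j / x $ j then 1 else 0)"
      using card_filter_eq_sum[of "T \<times> T"] by (simp add: E_def case_prod_unfold)
  qed simp
  also have "\<dots> = (\<Sum>(i, j)\<in>T \<times> T. card {y \<in> C. y $ i / x $ i = y $ j / x $ j})"
    by (subst sum.swap) (simp only: card_filter_eq_sum[OF fin(2)] case_prod_unfold)
  finally have "q * (\<Sum>y\<in>C. E y) = (\<Sum>(i, j)\<in>T \<times> T. q * card {y \<in> C. y $ i / x $ i = y $ j / x $ j})"
    by (simp add: sum_distrib_left case_prod_unfold)
  also have "\<dots> = (\<Sum>(i, j)\<in>T \<times> T. (if i = j then q else 1) * card C)"
    by (rule sum.cong) (auto simp: pairs)
  also have "\<dots> = (\<Sum>i\<in>T. \<Sum>j\<in>T. (if i = j then q else 1)) * card C"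
    by (simp add: sum.cartesian_product[symmetric] sum_distrib_right)
  also have "(\<Sum>i\<in>T. \<Sum>j\<in>T. (if i = j then q else 1)) = (\<Sum>i\<in>T. q + (N - 1))"
  proof (rule sum.cong)
    fix i assume i: "i \<in> T"
    have "(\<Sum>j\<in>T. if i = j then q else 1) = q + (\<Sum>j\<in>T - {i}. if i = j then q else 1)"
      by (simp add: sum.remove[OF fin(1) i])
    also have "(\<Sum>j\<in>T - {i}. if i = j then q else 1) = (\<Sum>j\<in>T - {i}. 1)"
      by (rule sum.cong) auto
    finally show "(\<Sum>j\<in>T. if i = j then q else 1) = q + (N - 1)" using i by (simp add: N_def)
  qed simp
  finally have total: "q * (\<Sum>y\<in>C. E y) = N * (q + (N - 1)) * card C" by (simp add: N_def)
  have "(\<Sum>y\<in>C. N\<^sup>2) \<le> (\<Sum>y\<in>C. (q - 1) * E y)" by (rule sum_mono) (rule lower)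
  then have "q * (card C * N\<^sup>2) \<le> q * ((q - 1) * (\<Sum>y\<in>C. E y))"
    by (intro mult_le_mono2) (simp add: sum_distrib_left)
  also have "\<dots> = (q - 1) * (N * (q + (N - 1)) * card C)"
    unfolding total[symmetric] by (simp add: mult_ac)
  finally have "(N * card C) * (q * N) \<le> (N * card C) * ((q - 1) * (q + (N - 1)))"
    by (simp add: power2_eq_square mult_ac)
  \<comment> \<open>Comparing the lower bound with the average leaves
    \<open>q * N \<le> (q - 1) * (q + (N - 1))\<close>, that is, \<open>N\<close> is at most the
    square of \<open>q - 1\<close>.\<close>
  moreover have "card C > 0" using x(1) by (auto simp: card_gt_0_iff)
  ultimately have le: "q * N \<le> (q - 1) * (q + (N - 1))" using N0 by simp
  obtain a where a: "q = Suc a" using q by (cases q) auto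
  obtain b where b: "N = Suc b" using N0 by (cases N) auto
  have "b < a\<^sup>2" using le by (simp add: a b power2_eq_square algebra_simps)
  then show False using T(2) a b by (simp add: q_def[symmetric] N_def[symmetric])
qed

subsection \<open>Griesmer codes and their shortened codes\<close>

text \<open>The coordinates lost by shortening are exactly those that define the same hyperplane, so
  the loss of length is the multiplicity of that hyperplane.\<close>

lemma card_eq_shorten_plus_supp:
  fixes C :: "('a::{field,finite} ^ 'n) set"
  assumes C: "vec.subspace C" and i: "i \<in> supp C"
  shows "card {j \<in> supp C. shorten C j = shorten C i} + card (supp (shorten C i)) = card (supp C)"
proof -
  have "{j \<in> supp C. shorten C j = shorten C i} = supp C - supp (shorten C i)"
  proof (intro equalityI subsetI)
    fix j assume j: "j \<in> supp C - supp (shorten C i)"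
    then have "shorten C i \<subseteq> shorten C j" by (auto simp: shorten_def supp_def)
    then show "j \<in> {j \<in> supp C. shorten C j = shorten C i}"
      using shorten_subset_imp_eq[OF C i, of j] j by auto
  next
    fix j assume "j \<in> {j \<in> supp C. shorten C j = shorten C i}"
    then have "j \<in> supp C" and eq: "shorten C j = shorten C i" by auto
    moreover have "j \<notin> supp (shorten C j)" by (auto simp: supp_def shorten_def)
    ultimately show "j \<in> supp C - supp (shorten C i)" by simp
  qed
  moreover have "supp (shorten C i) \<subseteq> supp C" by (auto simp: supp_def shorten_def)
  ultimately show ?thesis by (simp add: card_Diff_subset card_mono)
qed

text \<open>Here \<open>m\<close> is the last summand of the bound. Both \<open>d\<close> and
  \<open>(m - 1) * q ^ k\<close> are multiples of \<open>q ^ e\<close> and the latter is smaller, so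
  \<open>d \<ge> (m - 1) * q ^ k + q ^ e\<close>; divide by each \<open>q ^ i\<close> and
  sum.\<close>

lemma griesmer_bound_lower:
  assumes q: "q > 0" and d: "q ^ e dvd d" "d \<ge> 1" and e: "e \<le> k"
  defines "m \<equiv> nat \<lceil>real d / real q ^ k\<rceil>"
  shows "(m - 1) * (\<Sum>i<Suc k. q ^ i) + (\<Sum>i\<le>e. q ^ i) \<le> griesmer_bound q (Suc k) d"
proof -
  have m: "m \<ge> 1"
  proof -
    have "real d / real q ^ k > 0" using q d by simp
    then show ?thesis unfolding m_def by linarith
  qed
  have "real (m - 1) < real d / real q ^ k"
    using m unfolding m_def by linarith
  then have "real ((m - 1) * q ^ k) < real d" using q by (simp add: field_simps)
  then have lt: "(m - 1) * q ^ k < d" by linarith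
  moreover have "q ^ e dvd d - (m - 1) * q ^ k"
    using d(1) e by (intro dvd_diff_nat) (auto intro: dvd_mult le_imp_power_dvd)
  ultimately have "q ^ e \<le> d - (m - 1) * q ^ k" by (intro dvd_imp_le) auto
  then have dge: "(m - 1) * q ^ k + q ^ e \<le> d" using lt by linarith
  have "(m - 1) * q ^ (k - i) + (if i \<le> e then q ^ (e - i) else 0) \<le> nat \<lceil>real d / real q ^ i\<rceil>"
    if i: "i < Suc k" for i
  proof -
    have "((m - 1) * q ^ (k - i) + (if i \<le> e then q ^ (e - i) else 0)) * q ^ i \<le> (m - 1) * q ^ k + q ^ e"
      using i by (auto simp: distrib_right mult.assoc power_add[symmetric])
    then have "((m - 1) * q ^ (k - i) + (if i \<le> e then q ^ (e - i) else 0)) * q ^ i \<le> d"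
      using dge by linarith
    then have "real ((m - 1) * q ^ (k - i) + (if i \<le> e then q ^ (e - i) else 0)) * real (q ^ i) \<le> real d"
      by (metis of_nat_le_iff of_nat_mult)
    then have "real ((m - 1) * q ^ (k - i) + (if i \<le> e then q ^ (e - i) else 0)) \<le> real d / real q ^ i"
      using q by (simp add: pos_le_divide_eq del: of_nat_add of_nat_mult)
    then show ?thesis by linarith
  qed
  then have "(\<Sum>i<Suc k. (m - 1) * q ^ (k - i) + (if i \<le> e then q ^ (e - i) else 0)) \<le> griesmer_bound q (Suc k) d"
    unfolding griesmer_bound_def by (intro sum_mono) auto
  moreover have "(\<Sum>i<Suc k. q ^ (k - i)) = (\<Sum>i<Suc k. q ^ i)"
    using sum.nat_diff_reindex[of "\<lambda>i. q ^ i" "Suc k"] by simp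
  moreover have "(\<Sum>i<Suc k. if i \<le> e then q ^ (e - i) else 0) = (\<Sum>i\<le>e. q ^ i)"
  proof -
    have "(\<Sum>i<Suc k. if i \<le> e then q ^ (e - i) else 0) = (\<Sum>i\<in>{..<Suc e}. q ^ (e - i))"
      using e by (intro sum.mono_neutral_cong_right) auto
    then show ?thesis
      using sum.nat_diff_reindex[of "\<lambda>i. q ^ i" "Suc e"] by (simp add: lessThan_Suc_atMost)
  qed
  ultimately show ?thesis by (simp only: sum.distrib sum_distrib_left[symmetric])
qed

text \<open>A Griesmer code that need not have full length; its effective length is \<open>card (supp C)\<close>.\<close>

definition griesmer_subspace :: "('a::{field,finite} ^ 'n) set \<Rightarrow> nat \<Rightarrow> nat \<Rightarrow> bool"
  where "griesmer_subspace C k d \<longleftrightarrow>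
    vec.subspace C \<and> card C = CARD('a) ^ k \<and> (\<forall>c\<in>C - {0}. d \<le> wt_on UNIV c) \<and>
    card (supp C) \<le> griesmer_bound CARD('a) k d"

text \<open>The index \<open>k\<close> is the dimension of the hyperplanes, one less than that of
  \<open>C\<close>. For a Griesmer code with \<open>d \<ge> 1\<close> they are the hyperplanes of
  the maximal possible multiplicity, the ceiling of \<open>d / q ^ k\<close>.\<close>

definition griesmer_hyperplanes :: "('a::{field,finite} ^ 'n) set \<Rightarrow> nat \<Rightarrow> nat \<Rightarrow> ('a ^ 'n) set set"
  where "griesmer_hyperplanes C k d =
    {H \<in> shorten C ` supp C. card (supp H) \<le> griesmer_bound CARD('a) k d}"

lemma griesmer_subspace_hyperplane:
  assumes "griesmer_subspace C (Suc k) d" "H \<in> griesmer_hyperplanes C k d"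
  shows "griesmer_subspace H k d"
proof -
  obtain i where i: "i \<in> supp C" "H = shorten C i"
    using assms(2) by (auto simp: griesmer_hyperplanes_def)
  have "CARD('a) * card H = CARD('a) * CARD('a) ^ k"
    using card_shorten[of C i] i assms(1) by (simp add: griesmer_subspace_def)
  then have "card H = CARD('a) ^ k" by simp
  moreover have "vec.subspace H" "H \<subseteq> C"
    using assms(1) i by (auto simp: griesmer_subspace_def subspace_shorten) (simp add: shorten_def)
  ultimately show ?thesis
    using assms by (auto simp: griesmer_subspace_def griesmer_hyperplanes_def)
qed

text \<open>The Griesmer bound for hyperplanes caps multiplicities at \<open>m\<close>, and those
  outside \<open>?S\<close> have at most \<open>m - 1\<close>. As there are at most
  \<open>1 + q + \<dots> + q ^ k\<close> hyperplanes, the length in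
  \<open>griesmer_bound_lower\<close> forces enough members of \<open>?S\<close>.\<close>

lemma card_griesmer_hyperplanes:
  fixes C :: "('a::{field,finite} ^ 'n) set"
  assumes C: "griesmer_subspace C (Suc k) d" and d: "CARD('a) ^ e dvd d" "d \<ge> 1" and e: "e \<le> k"
  shows "(\<Sum>i\<le>e. CARD('a) ^ i) \<le> card (griesmer_hyperplanes C k d)"
proof -
  let ?q = "CARD('a)" and ?S = "griesmer_hyperplanes C k d"
  define m where "m = nat \<lceil>real d / real ?q ^ k\<rceil>"
  have sub: "vec.subspace C" and cardC: "card C = ?q ^ Suc k"
    and wt: "\<And>c. c \<in> C \<Longrightarrow> c \<noteq> 0 \<Longrightarrow> d \<le> wt_on UNIV c"
    and len: "card (supp C) \<le> griesmer_bound ?q (Suc k) d"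
    using C by (auto simp: griesmer_subspace_def)
  have q: "?q > 1" by (rule CARD_field_gt_1)
  have m: "m \<ge> 1"
  proof -
    have "real d / real ?q ^ k > 0" using q d by simp
    then show ?thesis unfolding m_def by linarith
  qed
  have gS: "griesmer_bound ?q (Suc k) d = griesmer_bound ?q k d + m"
    by (simp add: griesmer_bound_def m_def)
  have mult: "card {j \<in> supp C. shorten C j = H} \<le> (m - 1) + (if H \<in> ?S then 1 else 0)"
    if H: "H \<in> shorten C ` supp C" for H
  proof -
    obtain i where i: "i \<in> supp C" "H = shorten C i" using H by auto
    have "?q * card H = ?q * ?q ^ k" using card_shorten[OF sub i(1)] i cardC by simp
    moreover have "vec.subspace H" "H \<subseteq> C"
      using sub i by (auto simp: subspace_shorten) (simp add: shorten_def)
    ultimately have "griesmer_bound ?q k d \<le> card (UNIV \<inter> supp H)"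
      using wt d by (intro griesmer_bound_on) auto
    moreover have "card {j \<in> supp C. shorten C j = H} + card (supp H) = card (supp C)"
      using card_eq_shorten_plus_supp[OF sub i(1)] i by simp
    ultimately show ?thesis
      using len gS m H by (auto simp: griesmer_hyperplanes_def)
  qed
  have "card C = ?q ^ vec.dim C" by (rule card_subspace[OF sub])
  then have dim: "vec.dim C = Suc k" using cardC q by (simp add: power_inject_exp del: power_Suc)
  have "griesmer_bound ?q (Suc k) d \<le> card (supp C)"
    using griesmer_bound_on[OF sub cardC d(2), of UNIV] wt by simp
  also have "\<dots> = (\<Sum>H\<in>shorten C ` supp C. card {j \<in> supp C. shorten C j = H})"
    using sum.image_gen[of "supp C" "\<lambda>_. 1 :: nat" "shorten C"] by simp
  also have "\<dots> \<le> (\<Sum>H\<in>shorten C ` supp C. (m - 1) + (if H \<in> ?S then 1 else 0))"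
    by (intro sum_mono mult)
  also have "\<dots> = (m - 1) * card (shorten C ` supp C) + card {H \<in> shorten C ` supp C. H \<in> ?S}"
    by (simp add: sum.distrib card_filter_eq_sum)
  also have "{H \<in> shorten C ` supp C. H \<in> ?S} = ?S" by (auto simp: griesmer_hyperplanes_def)
  also have "(m - 1) * card (shorten C ` supp C) \<le> (m - 1) * (\<Sum>i<Suc k. ?q ^ i)"
    using card_shorten_image_le[OF sub] dim by (intro mult_le_mono2) simp
  finally show ?thesis
    using griesmer_bound_lower[of ?q e d k] q d e by (simp add: m_def del: sum.lessThan_Suc)
qed

section \<open>Codes of constant weight\<close>

lemma griesmer_bound_mult:
  assumes "q > 0" "q ^ k dvd d"
  shows "q ^ k * griesmer_bound q (Suc k) d = d * (\<Sum>i<Suc k. q ^ i)"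
proof -
  have "q ^ k * nat \<lceil>real d / real q ^ i\<rceil> = d * q ^ (k - i)" if i: "i < Suc k" for i
  proof -
    obtain c where c: "d = q ^ i * c" using assms(2) i by (meson dvdE less_Suc_eq_le power_le_dvd)
    then have "real d / real q ^ i = real c" using assms(1) by simp
    moreover have "q ^ k = q ^ (k - i) * q ^ i" using i by (simp add: power_add[symmetric])
    ultimately show ?thesis by (simp add: c)
  qed
  then have "q ^ k * griesmer_bound q (Suc k) d = (\<Sum>i<Suc k. d * q ^ (k - i))"
    unfolding griesmer_bound_def sum_distrib_left by (intro sum.cong) auto
  also have "\<dots> = d * (\<Sum>i<Suc k. q ^ i)"
    using sum.nat_diff_reindex[of "\<lambda>i. q ^ i" "Suc k"] by (simp only: sum_distrib_left[symmetric]) simp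
  finally show ?thesis .
qed

text \<open>Here the average weight of the nonzero words is already \<open>d\<close>.\<close>

lemma griesmer_subspace_constant_weight:
  fixes C :: "('a::{field,finite} ^ 'n) set"
  assumes C: "griesmer_subspace C (Suc k) d" and d: "CARD('a) ^ k dvd d" and c: "c \<in> C" "c \<noteq> 0"
  shows "wt_on UNIV c = d"
proof -
  let ?q = "CARD('a)"
  have sub: "vec.subspace C" and cardC: "card C = ?q ^ Suc k"
    and wt: "\<And>c. c \<in> C - {0} \<Longrightarrow> d \<le> wt_on UNIV c"
    and len: "card (supp C) \<le> griesmer_bound ?q (Suc k) d"
    using C by (auto simp: griesmer_subspace_def)
  have q: "?q > 1" by (rule CARD_field_gt_1)
  have "?q * (\<Sum>x\<in>C. wt_on UNIV x) = ?q * (?q ^ k * (?q - 1) * card (supp C))"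
    using sum_wt_subspace[OF sub] cardC by simp
  then have "(\<Sum>x\<in>C. wt_on UNIV x) = ?q ^ k * (?q - 1) * card (supp C)" using q by simp
  also have "\<dots> \<le> ?q ^ k * (?q - 1) * griesmer_bound ?q (Suc k) d" using len by simp
  also have "\<dots> = (?q - 1) * (?q ^ k * griesmer_bound ?q (Suc k) d)" by (simp only: mult_ac)
  also have "\<dots> = d * ((?q - 1) * (\<Sum>i<Suc k. ?q ^ i))"
    using griesmer_bound_mult[OF _ d] q by (simp only: mult_ac)
  also have "\<dots> = d * (card C - 1)" by (simp only: geometric_sum_nat_times cardC)
  also have "\<dots> = (\<Sum>x\<in>C - {0}. d)" using vec.subspace_0[OF sub] by simp
  finally have le: "(\<Sum>x\<in>C. wt_on UNIV x) \<le> (\<Sum>x\<in>C - {0}. d)" .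
  have "(\<Sum>x\<in>C. wt_on UNIV x) = (\<Sum>x\<in>C - {0}. wt_on UNIV x)"
    by (rule sum.mono_neutral_right) (auto simp: wt_on_def)
  then have "(\<Sum>x\<in>C - {0}. wt_on UNIV x) \<le> (\<Sum>x\<in>C - {0}. d)" using le by simp
  show ?thesis
  proof (rule ccontr)
    assume "wt_on UNIV c \<noteq> d"
    then have "d < wt_on UNIV c" using wt[of c] c by auto
    then have "(\<Sum>x\<in>C - {0}. d) < (\<Sum>x\<in>C - {0}. wt_on UNIV x)"
      using c wt by (intro sum_strict_mono_ex1) auto
    then show False using \<open>(\<Sum>x\<in>C - {0}. wt_on UNIV x) \<le> (\<Sum>x\<in>C - {0}. d)\<close> by linarith
  qed
qed

text \<open>Summing the weights in two ways gives
  \<open>q ^ a * (q - 1) * card (supp A) = (card A - 1) * d\<close>; cancel \<open>q ^ a\<close> and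
  use that \<open>q - 1\<close> is coprime to \<open>q\<close>.\<close>

lemma power_dvd_card_supp_constant_weight:
  fixes A :: "('a::{field,finite} ^ 'n) set"
  assumes A: "vec.subspace A" "card A = CARD('a) ^ Suc a"
    and wt: "\<And>c. c \<in> A \<Longrightarrow> c \<noteq> 0 \<Longrightarrow> wt_on UNIV c = d"
    and d: "CARD('a) ^ (a + b) dvd d"
  shows "CARD('a) ^ b dvd card (supp A)"
proof -
  let ?q = "CARD('a)"
  have q: "?q > 1" by (rule CARD_field_gt_1)
  have "(\<Sum>x\<in>A. wt_on UNIV x) = (\<Sum>x\<in>A - {0}. wt_on UNIV x)"
    by (rule sum.mono_neutral_right) (auto simp: wt_on_def)
  also have "\<dots> = (\<Sum>x\<in>A - {0}. d)" by (rule sum.cong) (use wt in auto)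
  finally have "?q * (?q ^ a * ((?q - 1) * card (supp A))) = ?q * (card (A - {0}) * d)"
    using sum_wt_subspace[OF A(1)] A(2) by (simp add: mult_ac)
  then have "?q ^ a * ((?q - 1) * card (supp A)) = card (A - {0}) * d" using q by simp
  then have "?q ^ a * ?q ^ b dvd ?q ^ a * ((?q - 1) * card (supp A))"
    using d by (simp add: power_add dvd_mult)
  then have "?q ^ b dvd (?q - 1) * card (supp A)" using q by simp
  moreover have "coprime (?q ^ b) (?q - 1)"
    using coprime_diff_one_left_nat[of ?q] q by (simp add: coprime_commute)
  ultimately show ?thesis by (simp add: coprime_dvd_mult_right_iff)
qed

subsection \<open>Divisibility\<close>

text \<open>Each further dimension costs one factor \<open>q = p ^ f\<close>, and a factor
  \<open>p\<close> is still left at \<open>s = e\<close>. The value 0 beyond that makes the claim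
  trivial and starts the downward induction on \<open>s\<close>.\<close>

definition supp_exponent :: "nat \<Rightarrow> nat \<Rightarrow> nat \<Rightarrow> nat"
  where "supp_exponent f e s = (if s \<le> e then f * (e - s) + 1 else 0)"

text \<open>Since \<open>q ^ k\<close> divides \<open>d\<close>, the code has constant weight. A
  subcode of dimension \<open>a + 1 \<le> s \<le> e\<close> then has support divisible by
  \<open>q ^ (e - a)\<close>, which is more than required.\<close>

lemma power_dvd_card_supp_small_dim:
  fixes C :: "('a::{field,finite} ^ 'n) set"
  assumes p: "CARD('a) = p ^ f" "f \<ge> 1" and C: "griesmer_subspace C (Suc k) d"
    and d: "CARD('a) ^ e dvd d" and k: "k \<le> e"
    and A: "vec.subspace A" "A \<subseteq> C" "card A \<le> CARD('a) ^ s"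
  shows "p ^ supp_exponent f e s dvd card (supp A)"
proof (cases "s \<le> e \<and> vec.dim A \<noteq> 0")
  case True
  then obtain a where a: "vec.dim A = Suc a" by (cases "vec.dim A") auto
  have cA: "card A = CARD('a) ^ Suc a" using card_subspace[OF A(1)] a by simp
  then have "Suc a \<le> s" using A(3) CARD_field_gt_1[where 'a = 'a]
    by (metis power_le_imp_le_exp)
  have "CARD('a) ^ k dvd d" using d k power_le_dvd by blast
  then have "CARD('a) ^ (e - a) dvd card (supp A)"
    using griesmer_subspace_constant_weight[OF C] A(2) d \<open>Suc a \<le> s\<close> True
    by (intro power_dvd_card_supp_constant_weight[OF A(1) cA, of d]) auto
  moreover have "f * (e - s) + 1 \<le> f * (e - a)"
  proof -
    have "f * (e - s) + 1 \<le> f * (e - s) + f" using p by simp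
    also have "\<dots> = f * (Suc (e - s))" by simp
    also have "\<dots> \<le> f * (e - a)" using \<open>Suc a \<le> s\<close> True by (intro mult_le_mono2) linarith
    finally show ?thesis .
  qed
  then have "p ^ (f * (e - s) + 1) dvd CARD('a) ^ (e - a)"
    unfolding p(1) power_mult[symmetric] by (rule le_imp_power_dvd)
  ultimately have "p ^ (f * (e - s) + 1) dvd card (supp A)" by (rule dvd_trans[rotated])
  then show ?thesis using True by (simp add: supp_exponent_def)
next
  case False
  show ?thesis
  proof (cases "s \<le> e")
    case True
    then have "card A = 1" using False card_subspace[OF A(1)] by simp
    then have "A = {0}" using vec.subspace_0[OF A(1)] by (auto simp: card_Suc_eq)
    then show ?thesis by (simp add: supp_def)
  qed (simp add: supp_exponent_def)
qed

text \<open>The top \<open>s\<close> terms on the right form the left side and a lower term remains.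
  This is the surplus of Griesmer hyperplanes over hyperplanes of a subcode of dimension
  \<open>s\<close> that feeds the pigeonhole principle.\<close>

lemma sum_powers_split:
  assumes "s \<le> e" "q > (0 :: nat)"
  shows "q ^ (Suc e - s) * (\<Sum>i<s. q ^ i) < (\<Sum>i\<le>e. q ^ i)"
proof -
  have split: "(\<Sum>i<m + n. q ^ i) = (\<Sum>i<m. q ^ i) + (\<Sum>i<n. q ^ (m + i))" for m n
    by (induction n) (simp_all add: add.assoc)
  have "(\<Sum>i\<le>e. q ^ i) = (\<Sum>i<Suc e - s + s. q ^ i)"
    using assms by (simp add: lessThan_Suc_atMost del: sum.lessThan_Suc)
  also have "\<dots> = (\<Sum>i<Suc e - s. q ^ i) + (\<Sum>i<s. q ^ (Suc e - s + i))"
    by (rule split)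
  also have "(\<Sum>i<s. q ^ (Suc e - s + i)) = q ^ (Suc e - s) * (\<Sum>i<s. q ^ i)"
    by (simp only: power_add sum_distrib_left)
  finally show ?thesis using assms by (simp add: Suc_diff_le)
qed

proposition power_dvd_card_supp:
  fixes C :: "('a::{field,finite} ^ 'n) set"
  assumes p: "prime p" "CARD('a) = p ^ f" "f \<ge> 1"
    and d: "CARD('a) ^ e dvd d" "d \<ge> 1"
    and C: "griesmer_subspace C (Suc k) d"
    and A: "vec.subspace A" "A \<subseteq> C" "card A \<le> CARD('a) ^ s"
  shows "p ^ supp_exponent f e s dvd card (supp A)"
  using C A
proof (induction k arbitrary: C A s)
  case 0
  then show ?case using power_dvd_card_supp_small_dim[OF p(2,3) 0(1) d(1)] by blast
next
  case (Suc k)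
  let ?q = "CARD('a)"
  note C = Suc.prems(1)
  have q: "?q > 1" by (rule CARD_field_gt_1)
  have sub: "vec.subspace C" using C by (simp add: griesmer_subspace_def)
  show ?case
  proof (cases "Suc k \<le> e")
    case True
    then show ?thesis using power_dvd_card_supp_small_dim[OF p(2,3) C d(1)] Suc.prems by blast
  next
    case False
    define S where "S = griesmer_hyperplanes C (Suc k) d"
    have cardS: "(\<Sum>i\<le>e. ?q ^ i) \<le> card S"
      unfolding S_def using False by (intro card_griesmer_hyperplanes[OF C d]) simp
    have IH: "p ^ supp_exponent f e s dvd card (supp A)"
      if "H \<in> S" "vec.subspace A" "A \<subseteq> H" "card A \<le> ?q ^ s" for H A s
      using Suc.IH[OF griesmer_subspace_hyperplane[OF C]] that by (simp add: S_def)
    show ?thesis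
      using Suc.prems(2-)
    \<comment> \<open>Inside the induction on the dimension, \<open>s\<close> runs downwards from
      values above \<open>e\<close>, so that the claim for \<open>Suc s\<close> is available as
      \<open>step\<close>.\<close>
    proof (induction "Suc e - s" arbitrary: s A)
      case 0
      then show ?case by (simp add: supp_exponent_def)
    next
      case (Suc r)
      note A = Suc.prems
      have s: "s \<le> e" using Suc.hyps(2) by simp
      have step: "p ^ supp_exponent f e (Suc s) dvd card (supp B)"
        if "vec.subspace B" "B \<subseteq> C" "card B \<le> ?q ^ Suc s" for B
        using Suc.hyps(2) by (intro Suc.hyps(1)[of "Suc s"] that) simp
      show ?case
      proof (cases "\<exists>H\<in>S. A \<subseteq> H")
        case True
        then show ?thesis using IH A by blast
      next
        case noH: False
        define a where "a = vec.dim A"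
        have "?q ^ a \<le> ?q ^ s" using A(3) card_subspace[OF A(1)] by (simp add: a_def)
        then have as: "a \<le> s" using q by (metis power_le_imp_le_exp)
        \<comment> \<open>No member of \<open>S\<close> contains \<open>A\<close>, so each cuts
          \<open>A\<close> in a hyperplane of \<open>A\<close>.\<close>
        have inter: "A \<inter> H \<in> shorten A ` supp A" if "H \<in> S" for H
        proof -
          obtain i where "i \<in> supp C" "H = shorten C i"
            using \<open>H \<in> S\<close> by (auto simp: S_def griesmer_hyperplanes_def)
          then have "A \<inter> H = shorten A i" using A(2) by (auto simp: shorten_def)
          moreover have "i \<in> supp A"
            using noH \<open>H \<in> S\<close> \<open>H = shorten C i\<close> A(2) by (auto simp: shorten_def supp_def)
          ultimately show ?thesis by simp
        qed
        have "card ((\<inter>) A ` S) \<le> card (shorten A ` supp A)" by (intro card_mono) (auto simp: inter)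
        also have "\<dots> \<le> (\<Sum>i<a. ?q ^ i)" unfolding a_def by (rule card_shorten_image_le[OF A(1)])
        also have "\<dots> \<le> (\<Sum>i<s. ?q ^ i)" using as by (intro sum_mono2) auto
        finally have "card ((\<inter>) A ` S) * ?q ^ (Suc e - s) \<le> ?q ^ (Suc e - s) * (\<Sum>i<s. ?q ^ i)"
          by (simp add: mult.commute)
        also have "\<dots> < card S" using sum_powers_split[OF s, of ?q] q cardS by linarith
        finally have lt: "card ((\<inter>) A ` S) * ?q ^ (Suc e - s) < card S" .
        obtain A1 where A1: "A1 \<in> (\<inter>) A ` S"
          and many: "?q ^ (Suc e - s) < card {H \<in> S. A \<inter> H = A1}"
          using pigeonhole_fibre[OF finite lt] by blast
        obtain j where j: "j \<in> supp A" "A1 = shorten A j" using A1 inter by blast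
        have A1sub: "vec.subspace A1" using j A(1) by (simp add: subspace_shorten)
        have A1card: "?q * card A1 = card A" using j card_shorten[OF A(1)] by simp
        obtain x where x: "x \<in> A" "x $ j \<noteq> 0" using j by (auto simp: supp_def)
        \<comment> \<open>\<open>T\<close> picks one coordinate for each Griesmer hyperplane meeting
          \<open>A\<close> in \<open>A1\<close>; \<open>x\<close> is nonzero at all of them because
          it is outside \<open>A1\<close>.\<close>
        have "{H \<in> S. A \<inter> H = A1} \<subseteq> shorten C ` supp C"
          by (auto simp: S_def griesmer_hyperplanes_def)
        from iffD1[OF subset_image_inj this] obtain T
          where T: "T \<subseteq> supp C" "inj_on (shorten C) T" "{H \<in> S. A \<inter> H = A1} = shorten C ` T"
          by blast
        have cardT: "?q ^ (Suc e - s) < card T" using many T by (simp add: card_image)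
        have TS: "shorten C i \<in> S" "A \<inter> shorten C i = A1" if "i \<in> T" for i using T(3) that by blast+
        have xT: "x $ i \<noteq> 0" if "i \<in> T" for i
        proof
          assume "x $ i = 0"
          then have "x \<in> A1" using TS(2)[OF that] x A(2) by (auto simp: shorten_def)
          then show False using x j by (simp add: shorten_def)
        qed
        define I where "I = - supp A1"
        have spanC: "vec.span B \<subseteq> C" if "B \<subseteq> C" for B using that sub by (rule vec.span_minimal)
        have A1C: "A1 \<subseteq> C" using j A(2) by (auto simp: shorten_def)
        obtain i0 where i0: "i0 \<in> T" using cardT by (metis card.empty ex_in_conv not_less_zero)
        have A1dvd: "p ^ supp_exponent f e s dvd card (supp A1)"
        proof (rule IH[OF TS(1)[OF i0] A1sub])
          show "A1 \<subseteq> shorten C i0" using TS(2)[OF i0] by blast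
          show "card A1 \<le> ?q ^ s"
          proof -
            have "card A1 \<le> ?q * card A1" using q by simp
            then show ?thesis using A1card A(3) by linarith
          qed
        qed
        \<comment> \<open>The span of \<open>y\<close> and \<open>A1\<close> is no larger than
          \<open>A\<close> and lies in a Griesmer hyperplane, so the outer induction controls its
          support; subtracting that of \<open>A1\<close> leaves the weight of \<open>y\<close> on
          \<open>I\<close>.\<close>
        have wt0: "p ^ supp_exponent f e s dvd wt_on I y" if y: "y \<in> C" "i \<in> T" "y $ i = 0" for y i
        proof -
          have "insert y A1 \<subseteq> shorten C i"
            using y TS(2)[OF y(2)] by (auto simp: shorten_def)
          then have "vec.span (insert y A1) \<subseteq> shorten C i"
            using subspace_shorten[OF sub] by (intro vec.span_minimal)
          moreover have "card (vec.span (insert y A1)) \<le> ?q ^ s"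
            using card_span_insert_le[OF A1sub, of y] A1card A(3) by linarith
          ultimately have "p ^ supp_exponent f e s dvd card (supp (vec.span (insert y A1)))"
            using IH[OF TS(1)[OF y(2)]] by blast
          then show ?thesis
            using A1dvd by (simp add: supp_span card_supp_insert I_def dvd_add_right_iff)
        qed
        have "p ^ supp_exponent f e s dvd wt_on I x"
        proof (cases "s = e")
          case True
          \<comment> \<open>For \<open>s = e\<close> the exponent is 1 and \<open>T\<close> has more
            than \<open>q\<close> elements, exceeding the degree \<open>q - 1\<close> of the weight
            modulo \<open>p\<close>.\<close>
          have "of_nat (wt_on I x) = (0 :: 'a)"
          proof (rule poly_fun_vanish[OF poly_fun_wt_on _ sub T(1,2)])
            show "?q - 1 < card T" using cardT True by simp
            fix i c assume "i \<in> T" "c \<in> shorten C i"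
            then have "p dvd wt_on I c"
              using wt0[of c i] True by (auto simp: supp_exponent_def shorten_def)
            then show "of_nat (wt_on I c) = (0 :: 'a)"
              using of_nat_eq_0_iff_dvd_prime[OF p(1,2)] by blast
          qed (use q x A(2) in auto)
          then have "p dvd wt_on I x" using of_nat_eq_0_iff_dvd_prime[OF p(1,2)] by blast
          then show ?thesis using True by (simp add: supp_exponent_def)
        next
          case False
          \<comment> \<open>For \<open>s < e\<close> the set \<open>T\<close> has more than
            \<open>q ^ 2\<close> elements, enough for \<open>exists_all_ratios\<close>: every
            \<open>y - t *s x\<close> then vanishes at some coordinate of \<open>T\<close>, where
            \<open>wt0\<close> applies.\<close>
          have "(?q - 1)\<^sup>2 \<le> ?q ^ 2" by (intro power_mono) auto
          also have "\<dots> \<le> ?q ^ (Suc e - s)" using q s False by (intro power_increasing) auto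
          also have "\<dots> < card T" by (rule cardT)
          finally obtain y where y: "y \<in> C" "\<And>t. \<exists>i\<in>T. y $ i = t * x $ i"
            using exists_all_ratios[OF sub T(2) _ _ xT] x(1) A(2) by blast
          have dvd_t: "p ^ supp_exponent f e s dvd wt_on I (y - t *s x)" for t
          proof -
            obtain i where "i \<in> T" "y $ i = t * x $ i" using y(2) by blast
            moreover have "y - t *s x \<in> C"
              using y(1) x(1) A(2) sub by (auto intro!: vec.subspace_diff vec.subspace_scale)
            ultimately show ?thesis by (intro wt0) auto
          qed
          have exp: "supp_exponent f e s = f + supp_exponent f e (Suc s)"
          proof -
            have "e - s = Suc (e - Suc s)" using s False by simp
            then show ?thesis using s False by (simp add: supp_exponent_def)
          qed
          have "p ^ supp_exponent f e (Suc s) dvd card {i \<in> I. x $ i \<noteq> 0 \<or> y $ i \<noteq> 0}"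
          proof -
            \<comment> \<open>\<open>A1\<close> has one dimension less than \<open>A\<close>, so
              adjoining \<open>x\<close> and \<open>y\<close> stays within dimension
              \<open>Suc s\<close>, where \<open>step\<close> holds.\<close>
            let ?B = "vec.span (insert y (vec.span (insert x A1)))"
            have "insert x A1 \<subseteq> C" using x(1) A(2) A1C by blast
            then have "insert y (vec.span (insert x A1)) \<subseteq> C" using spanC y(1) by simp
            then have span2: "?B \<subseteq> C" by (rule spanC)
            have "card ?B \<le> ?q * card (vec.span (insert x A1))"
              by (rule card_span_insert_le) simp
            also have "\<dots> \<le> ?q * (?q * card A1)"
              using card_span_insert_le[OF A1sub] by (intro mult_le_mono2)
            also have "\<dots> \<le> ?q ^ Suc s" using A1card A(3) by simp
            finally have "p ^ supp_exponent f e (Suc s) dvd card (supp ?B)"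
              using span2 by (intro step) simp_all
            moreover have "supp ?B = supp A1 \<union> {i \<in> I. x $ i \<noteq> 0 \<or> y $ i \<noteq> 0}"
              by (auto simp: supp_span supp_insert I_def)
            then have "card (supp ?B) = card (supp A1) + card {i \<in> I. x $ i \<noteq> 0 \<or> y $ i \<noteq> 0}"
              by (simp only:) (rule card_Un_disjoint, auto simp: I_def)
            moreover have "p ^ supp_exponent f e (Suc s) dvd card (supp A1)"
              using A1dvd exp by (metis dvd_trans le_add2 le_imp_power_dvd)
            ultimately show ?thesis by (simp add: dvd_add_right_iff)
          qed
          \<comment> \<open>The factor \<open>q = p ^ f\<close> from \<open>pencil_wt\<close> makes
            up exactly for the \<open>f\<close> lost in the exponent between \<open>s\<close> and
            \<open>Suc s\<close>.\<close>
          then have "p ^ supp_exponent f e s dvd ?q * card {i \<in> I. x $ i \<noteq> 0 \<or> y $ i \<noteq> 0}"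
            using exp p(2) by (simp add: power_add mult_dvd_mono)
          then have "p ^ supp_exponent f e s dvd (\<Sum>t\<in>UNIV. wt_on I (y - t *s x)) + wt_on I x"
            by (simp only: pencil_wt)
          moreover have "p ^ supp_exponent f e s dvd (\<Sum>t\<in>UNIV. wt_on I (y - t *s x))"
            by (intro dvd_sum dvd_t)
          ultimately show ?thesis by (simp add: dvd_add_right_iff)
        qed
        moreover have "supp A = supp (insert x A1)"
        proof -
          have "a \<in> vec.span (insert x A1)" if a: "a \<in> A" for a
          proof -
            have "a - (a $ j / x $ j) *s x \<in> A1"
              using a x A(1) unfolding j(2) shorten_def
              by (auto intro!: vec.subspace_diff vec.subspace_scale)
            then show ?thesis by (auto simp: vec.span_insert intro: vec.span_base)
          qed
          then have "supp A \<subseteq> supp (vec.span (insert x A1))" by (auto simp: supp_def)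
          moreover have "supp (insert x A1) \<subseteq> supp A" using x j by (auto simp: supp_def shorten_def)
          ultimately show ?thesis by (simp add: supp_span)
        qed
        ultimately show ?thesis using A1dvd by (simp add: card_supp_insert I_def)
      qed
    qed
  qed
qed

section \<open>From supports of one-dimensional subcodes to the stated divisor\<close>

theorem theorem1p8:
  fixes p f q k d e :: nat
    and C :: "('a::{field,finite} ^ 'n) set"
  assumes "prime p" and "f \<ge> 1" and "q = p ^ f"
    and "k \<ge> 1" and "d \<ge> 1"
    and "griesmer_code C k d q"
    and "p ^ e dvd d"
  shows "\<forall>c\<in>C. \<lceil>real p powi (int e - (int f - 1) * (int q - 2))\<rceil> dvd int (hamming_weight c)"
proof
  fix c assume c: "c \<in> C"
  define E where "E = int e - (int f - 1) * (int q - 2)"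
  define e1 where "e1 = e div f"
  have code: "CARD('a) = q" "CARD('n) = griesmer_bound q k d" "vec.subspace C" "vec.dim C = k"
    "minimum_weight C = d" "full_length C"
    using assms(6) by (auto simp: griesmer_code_def linear_code_def)
  have p: "p > 1" using assms(1) by (rule prime_gt_1_nat)
  obtain k' where k': "k = Suc k'" using assms(4) by (cases k) auto
  have "supp C = UNIV" using code(6) by (auto simp: full_length_def supp_def)
  moreover have "d \<le> wt_on UNIV x" if "x \<in> C - {0}" for x
    using code(5) that by (auto simp: minimum_weight_def wt_on_def hamming_weight_def)
  ultimately have C: "griesmer_subspace C (Suc k') d"
    using code card_subspace[OF code(3)] k' by (simp add: griesmer_subspace_def)
  have "q ^ e1 dvd p ^ e"
    unfolding assms(3) power_mult[symmetric] e1_def by (intro le_imp_power_dvd) simp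
  then have d: "CARD('a) ^ e1 dvd d" using code(1) assms(7) dvd_trans by blast
  have "card (vec.span (insert c {0})) \<le> CARD('a) * card {0 :: 'a ^ 'n}"
    by (rule card_span_insert_le) simp
  moreover have "vec.span {c, 0} \<subseteq> C"
    using c vec.subspace_0[OF code(3)] code(3) by (intro vec.span_minimal) simp_all
  moreover have "CARD('a) = p ^ f" using code(1) assms(3) by simp
  ultimately have "p ^ supp_exponent f e1 1 dvd card (supp (vec.span {c, 0}))"
    by (intro power_dvd_card_supp[OF assms(1) _ assms(2) d assms(5) C]) simp_all
  moreover have "supp {c, 0} = {i. c $ i \<noteq> 0}" by (auto simp: supp_def)
  ultimately have dvd: "p ^ supp_exponent f e1 1 dvd hamming_weight c"
    by (simp add: supp_span hamming_weight_def)
  show "\<lceil>real p powi (int e - (int f - 1) * (int q - 2))\<rceil> dvd int (hamming_weight c)"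
    unfolding E_def[symmetric]
  proof (cases "E \<le> 0")
    case True
    \<comment> \<open>A power of \<open>p\<close> with exponent at most 0 lies in the interval from
      0 (excluded) to 1, so its ceiling is 1.\<close>
    obtain n where "E = - int n" using True by (metis nonpos_int_cases)
    then have "real p powi E = inverse (real p ^ n)" by (simp add: power_int_minus)
    moreover have "1 \<le> real p ^ n" using p by (intro one_le_power) simp
    ultimately have "0 < real p powi E" "real p powi E \<le> 1"
      using p by (simp_all add: inverse_le_1_iff)
    then have "\<lceil>real p powi E\<rceil> = 1" by linarith
    then show "\<lceil>real p powi E\<rceil> dvd int (hamming_weight c)" by simp
  next
    case False
    have e: "e < f + f * e1"
      unfolding e1_def using assms(2) dividend_less_times_div[of f e] by linarith
    define u where "u = int (f * e1)"
    from e have e_int: "int e < int f + u" unfolding u_def by (metis of_nat_add of_nat_less_iff)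
    have "nat E \<le> supp_exponent f e1 1"
    proof (cases "f = 1")
      case True
      then show ?thesis using False by (simp add: E_def e1_def supp_exponent_def)
    next
      case f: False
      \<comment> \<open>With \<open>f \<ge> 2\<close> the factor \<open>q - 2\<close> is at least 2.
        Together with \<open>e \<le> f * e1 + f - 1\<close> this bounds \<open>E\<close> by
        \<open>f * e1 - f + 1\<close>, which is \<open>supp_exponent f e1 1\<close> once
        \<open>e1 \<ge> 1\<close>.\<close>
      have "2 ^ 2 \<le> q"
        unfolding assms(3) using f p assms(2)
        by (intro order_trans[OF power_mono[of 2 p 2] power_increasing[of 2 f p]]) auto
      then have "2 \<le> int q - 2" by simp
      then have "(int f - 1) * 2 \<le> (int f - 1) * (int q - 2)"
        using assms(2) by (intro mult_left_mono) simp_all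
      then have "E \<le> int e - 2 * (int f - 1)" by (simp add: E_def)
      then have E: "E \<le> u - int f + 1"
        using e_int by presburger
      \<comment> \<open>If \<open>e1\<close> were 0, the bound would give
        \<open>E \<le> 1 - f < 0\<close>, against \<open>E > 0\<close>.\<close>
      obtain r where r: "e1 = Suc r"
      proof (cases e1)
        case 0
        then show ?thesis using E False f assms(2) by (simp add: u_def)
      qed
      then show ?thesis using E by (simp add: supp_exponent_def u_def nat_le_iff)
    qed
    then have "p ^ nat E dvd hamming_weight c" using dvd power_le_dvd by blast
    moreover have "real p powi E = real (p ^ nat E)" using False by (simp add: power_int_def)
    ultimately show "\<lceil>real p powi E\<rceil> dvd int (hamming_weight c)"
      by (simp only: ceiling_of_nat of_nat_dvd_iff)
  qed
qed

end
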